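(* Let $R>0$, $\Lambda:=\{\lambda\in\mathbb{R}_+^m:\|\lambda\|_1\le R\}$, and let $\mathcal{O}_\rho$ be a $\rho$-approximate Bayesian optimization oracle. Let $(\theta^{(t)},\lambda^{(t)})_{t=1}^T$ be produced by the oracle-Lagrangian algorithm (described in the context), let $B_\Delta>0$ satisfy $B_\Delta\ge\max_{t\in\{1,\dots,T\}}\|\Delta_\lambda^{(t)}\|_2$, and suppose the algorithm is run with step size $\eta_\lambda:=R/(B_\Delta\sqrt{2T})$. Then $$\max_{\lambda^*\in\Lambda}\frac1T\sum_{t=1}^T\mathcal{L}(\theta^{(t)},\lambda^* )-\inf_{\theta^*\in\Theta}\frac1T\sum_{t=1}^T\mathcal{L}(\theta^*,\lambda^{(t)})\le\rho+RB_\Delta\sqrt{\frac2T}.$$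
   Context: $\Theta$ is a (nonempty) set and $g_0,g_1,\dots,g_m:\Theta\to\mathbb{R}$ are functions. The Lagrangian is $\mathcal{L}(\theta,\lambda):=g_0(\theta)+\sum_{i=1}^m\lambda_ig_i(\theta)$. A $\rho$-approximate Bayesian optimization oracle is a function $\mathcal{O}_\rho:(\Theta\to\mathbb{R})\to\Theta$ such that $f(\mathcal{O}_\rho(f))\le\inf_{\theta^*\in\Theta}f(\theta^* )+\rho$ for every $f:\Theta\to\mathbb{R}$ that is a nonnegative linear combination of $g_0,g_1,\dots,g_m$. Oracle-Lagrangian algorithm (inputs $R$, $\mathcal{L}$, $\mathcal{O}_\rho$, $T\in\mathbb{N}$, $T\ge1$, $\eta_\lambda$): set $\lambda^{(1)}=0$. For $t=1,\dots,T$: let $\theta^{(t)}=\mathcal{O}_\rho(\mathcal{L}(\cdot,\lambda^{(t)}))$; let $\Delta_\lambda^{(t)}$ be the gradient of $\mathcal{L}(\theta^{(t)},\cdot)$ at $\lambda^{(t)}$, i.e. $\Delta_\lambda^{(t)}=(g_1(\theta^{(t)}),\dots,g_m(\theta^{(t)}))$; let $\lambda^{(t+1)}=\Pi_\Lambda(\lambda^{(t)}+\eta_\lambda\Delta_\lambda^{(t)})$, where $\Pi_\Lambda$ is Euclidean projection onto $\Lambda$. *)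

theory Defs
  imports "HOL-Analysis.Analysis"
begin

text \<open>
  The constraint functions are indexed by a finite type \<open>'m\<close>, so that multiplier vectors live in
  \<open>real ^ 'm\<close>, whose \<open>norm\<close> and \<open>dist\<close> are Euclidean. The domain is a set \<open>\<Theta>\<close> in an arbitrary
  type \<open>'a\<close>; real-valued functions on \<open>\<Theta>\<close> are represented by functions on \<open>'a\<close>.
\<close>

definition lagrangian ::
  "('a \<Rightarrow> real) \<Rightarrow> ('m::finite \<Rightarrow> 'a \<Rightarrow> real) \<Rightarrow> 'a \<Rightarrow> real ^ 'm \<Rightarrow> real" where
  "lagrangian g0 g \<theta> l = g0 \<theta> + (\<Sum>i\<in>UNIV. l $ i * g i \<theta>)"

definition multipliers :: "real \<Rightarrow> (real ^ 'm::finite) set" where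
  "multipliers R = {l. (\<forall>i. 0 \<le> l $ i) \<and> (\<Sum>i\<in>UNIV. \<bar>l $ i\<bar>) \<le> R}"

definition constraint_vec :: "('m::finite \<Rightarrow> 'a \<Rightarrow> real) \<Rightarrow> 'a \<Rightarrow> real ^ 'm" where
  "constraint_vec g \<theta> = (\<chi> i. g i \<theta>)"

lemma gderiv_lagrangian: "GDERIV (lagrangian g0 g \<theta>) l :> constraint_vec g \<theta>"
  unfolding gderiv_def lagrangian_def constraint_vec_def inner_vec_def
  by (auto intro!: derivative_eq_intros bounded_linear.has_derivative[OF bounded_linear_vec_nth])

definition nonneg_combination ::
  "('a \<Rightarrow> real) \<Rightarrow> ('m::finite \<Rightarrow> 'a \<Rightarrow> real) \<Rightarrow> ('a \<Rightarrow> real) \<Rightarrow> bool" where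
  "nonneg_combination g0 g f \<longleftrightarrow>
    (\<exists>c0 c. 0 \<le> c0 \<and> (\<forall>i. 0 \<le> c i) \<and> f = (\<lambda>\<theta>. c0 * g0 \<theta> + (\<Sum>i\<in>UNIV. c i * g i \<theta>)))"

text \<open>
  The infimum is taken in the extended reals: if \<open>f\<close> is unbounded below on \<open>\<Theta>\<close>, it is \<open>-\<infinity>\<close> and
  the inequality fails, whereas the infimum in \<open>real\<close> would be an unspecified number.
\<close>

definition approx_bo_oracle ::
  "'a set \<Rightarrow> ('a \<Rightarrow> real) \<Rightarrow> ('m::finite \<Rightarrow> 'a \<Rightarrow> real) \<Rightarrow> real \<Rightarrow> (('a \<Rightarrow> real) \<Rightarrow> 'a) \<Rightarrow> bool" where
  "approx_bo_oracle \<Theta> g0 g \<rho> Orc \<longleftrightarrow>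
    (\<forall>f. Orc f \<in> \<Theta>) \<and>
    (\<forall>f. nonneg_combination g0 g f \<longrightarrow>
      ereal (f (Orc f)) \<le> (INF \<theta>\<in>\<Theta>. ereal (f \<theta>)) + ereal \<rho>)"

text \<open>
  The sequences are only constrained at indices \<open>1, \<dots>, T\<close> (and \<open>T + 1\<close> for the multipliers).
\<close>

definition oracle_lagrangian_run ::
  "real \<Rightarrow> ('a \<Rightarrow> real) \<Rightarrow> ('m::finite \<Rightarrow> 'a \<Rightarrow> real) \<Rightarrow> (('a \<Rightarrow> real) \<Rightarrow> 'a) \<Rightarrow> nat \<Rightarrow> real \<Rightarrow>
   (nat \<Rightarrow> 'a) \<Rightarrow> (nat \<Rightarrow> real ^ 'm) \<Rightarrow> bool" where
  "oracle_lagrangian_run R g0 g Orc T \<eta> \<theta> l \<longleftrightarrow>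
    l 1 = 0 \<and>
    (\<forall>t\<in>{1..T}.
      \<theta> t = Orc (\<lambda>x. lagrangian g0 g x (l t)) \<and>
      l (t + 1) = closest_point (multipliers R) (l t + \<eta> *\<^sub>R constraint_vec g (\<theta> t)))"

end

theory Submission imports Defs begin

text \<open>
  Since \<open>\<theta> t\<close> is a \<open>\<rho>\<close>-best response to \<open>l t\<close>, the infimum term is at least
  \<open>1 / T * (\<Sum>t=1..T. \<L>(\<theta> t, l t)) - \<rho>\<close>. The Lagrangian is affine in the multipliers, so the
  remaining gap between the maximum term and \<open>1 / T * (\<Sum>t=1..T. \<L>(\<theta> t, l t))\<close> is the average
  regret of projected online gradient ascent. Expanding the squared distance to the comparator
  and telescoping bounds the regret by \<open>R\<^sup>2 / (2 * \<eta>) + \<eta> * T * B\<^sup>2 / 2\<close>, which for the given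
  step size is \<open>3/4 * R * B * sqrt (2 * T)\<close>.
\<close>

text \<open>Projection onto \<open>S\<close> is nonexpansive and fixes \<open>u\<close>, so the
  projected iterate is no farther from \<open>u\<close> than the unprojected step. The final
  distance stays on the right so that the induction telescopes.\<close>

lemma projected_ascent_regret:
  fixes x d :: "nat \<Rightarrow> 'a::euclidean_space"
  assumes S: "convex S" "closed S" and u: "u \<in> S"
    and step: "\<And>t. t \<in> {1..T} \<Longrightarrow> x (t + 1) = closest_point S (x t + \<eta> *\<^sub>R d t)"
  shows "2 * \<eta> * (\<Sum>t=1..T. (u - x t) \<bullet> d t)
    \<le> (norm (u - x 1))\<^sup>2 - (norm (u - x (T + 1)))\<^sup>2 + \<eta>\<^sup>2 * (\<Sum>t=1..T. (norm (d t))\<^sup>2)"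
  using step
proof (induction T)
  case 0
  then show ?case by simp
next
  case (Suc T)
  let ?y = "x (T + 1) + \<eta> *\<^sub>R d (T + 1)"
  have "dist (closest_point S u) (closest_point S ?y) \<le> dist u ?y"
    using S u by (intro closest_point_lipschitz) auto
  then have "norm (u - x (T + 2)) \<le> norm ((u - x (T + 1)) - \<eta> *\<^sub>R d (T + 1))"
    using Suc.prems[of "Suc T"] u by (simp add: closest_point_self dist_norm algebra_simps)
  then have "(norm (u - x (T + 2)))\<^sup>2 \<le> (norm ((u - x (T + 1)) - \<eta> *\<^sub>R d (T + 1)))\<^sup>2"
    by (simp add: power_mono)
  also have "\<dots> = (norm (u - x (T + 1)))\<^sup>2 - 2 * \<eta> * ((u - x (T + 1)) \<bullet> d (T + 1))
      + \<eta>\<^sup>2 * (norm (d (T + 1)))\<^sup>2"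
    unfolding power2_norm_eq_inner
    by (simp add: inner_diff inner_commute power2_eq_square algebra_simps)
  finally show ?case
    using Suc by (simp add: distrib_left)
qed

text \<open>The Euclidean norm is at most the l1 norm. This will bound the distance from the
  starting point \<open>0\<close> to any comparator.\<close>

lemma norm_multipliers_le:
  assumes "l \<in> multipliers R"
  shows "norm l \<le> R"
  using assms norm_le_l1_cart[of l] by (auto simp: multipliers_def)

lemma zero_in_multipliers: "0 \<le> R \<Longrightarrow> 0 \<in> multipliers R"
  by (simp add: multipliers_def)

lemma convex_multipliers: "convex (multipliers R)"
proof (rule convexI)
  fix x y :: "real ^ 'm::finite" and a b :: real
  assume x: "x \<in> multipliers R" and y: "y \<in> multipliers R"
    and ab: "0 \<le> a" "0 \<le> b" "a + b = 1"
  \<comment> \<open>Equality holds, not just the triangle inequality: on nonnegative vectors the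
    absolute values disappear.\<close>
  have "(\<Sum>i\<in>UNIV. \<bar>(a *\<^sub>R x + b *\<^sub>R y) $ i\<bar>) = a * (\<Sum>i\<in>UNIV. \<bar>x $ i\<bar>) + b * (\<Sum>i\<in>UNIV. \<bar>y $ i\<bar>)"
    using x y ab by (simp add: multipliers_def sum.distrib sum_distrib_left)
  also have "\<dots> \<le> R"
    using x y ab by (intro convex_bound_le) (auto simp: multipliers_def)
  finally show "a *\<^sub>R x + b *\<^sub>R y \<in> multipliers R"
    using x y ab by (auto simp: multipliers_def)
qed

text \<open>Closedness serves the projection, compactness the existence of a maximizing
  multiplier.\<close>

lemma compact_multipliers: "compact (multipliers R)"
proof -
  have "closed (multipliers R)"
    unfolding multipliers_def
    by (intro closed_Collect_conj closed_Collect_all closed_Collect_le continuous_intros)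
  moreover have "bounded (multipliers R)"
    using norm_multipliers_le by (auto simp: bounded_iff)
  ultimately show ?thesis
    by (simp add: compact_eq_bounded_closed)
qed

lemma lagrangian_eq_inner: "lagrangian g0 g \<theta> l = g0 \<theta> + l \<bullet> constraint_vec g \<theta>"
  by (simp add: lagrangian_def constraint_vec_def inner_vec_def)

text \<open>The oracle guarantee covers nonnegative combinations only, so the iterates must be
  nonnegative: the first is \<open>0\<close>, every later one is a projection onto the set.\<close>

lemma oracle_lagrangian_run_multipliers:
  assumes "0 \<le> R" and run: "oracle_lagrangian_run R g0 g Orc T \<eta> \<theta> l" and "t \<in> {1..T}"
  shows "l t \<in> multipliers R"
proof (cases "t = 1")
  case True
  then show ?thesis
    using assms by (simp add: oracle_lagrangian_run_def zero_in_multipliers)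
next
  case False
  then have "t - 1 \<in> {1..T}" "t = (t - 1) + 1"
    using \<open>t \<in> {1..T}\<close> by auto
  then have "l t = closest_point (multipliers R) (l (t - 1) + \<eta> *\<^sub>R constraint_vec g (\<theta> (t - 1)))"
    using run unfolding oracle_lagrangian_run_def by metis
  then show ?thesis
    using closest_point_in_set[OF compact_imp_closed[OF compact_multipliers]]
      zero_in_multipliers[OF \<open>0 \<le> R\<close>] by auto
qed

text \<open>The bound against the infimum is turned into a real inequality against each fixed
  competitor, which can be summed over the rounds.\<close>

lemma approx_bo_oracle_lagrangian:
  assumes orc: "approx_bo_oracle \<Theta> g0 g \<rho> Orc" and l: "l \<in> multipliers R" and "\<theta>' \<in> \<Theta>"
  shows "lagrangian g0 g (Orc (\<lambda>x. lagrangian g0 g x l)) l \<le> lagrangian g0 g \<theta>' l + \<rho>"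
proof -
  let ?f = "\<lambda>x. lagrangian g0 g x l"
  \<comment> \<open>The weights are \<open>1\<close> for \<open>g0\<close> and the entries of
    \<open>l\<close> for the constraints.\<close>
  have "nonneg_combination g0 g ?f"
    unfolding nonneg_combination_def lagrangian_def
    using l by (intro exI[of _ 1] exI[of _ "\<lambda>i. l $ i"]) (auto simp: multipliers_def)
  then have "ereal (?f (Orc ?f)) \<le> (INF \<theta>\<in>\<Theta>. ereal (?f \<theta>)) + ereal \<rho>"
    using orc unfolding approx_bo_oracle_def by blast
  also have "\<dots> \<le> ereal (?f \<theta>') + ereal \<rho>"
    using \<open>\<theta>' \<in> \<Theta>\<close> by (intro add_right_mono INF_lower)
  finally show ?thesis by simp
qed

lemma oracle_lagrangian_regret:
  fixes l :: "nat \<Rightarrow> real ^ 'm::finite"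
  assumes "R > 0" "T \<ge> 1" "B > 0" and run: "oracle_lagrangian_run R g0 g Orc T \<eta> \<theta> l"
    and B: "\<And>t. t \<in> {1..T} \<Longrightarrow> norm (constraint_vec g (\<theta> t)) \<le> B"
    and eta: "\<eta> = R / (B * sqrt (2 * real T))" and u: "u \<in> multipliers R"
  shows "(\<Sum>t=1..T. (u - l t) \<bullet> constraint_vec g (\<theta> t)) \<le> 3/4 * R * B * sqrt (2 * real T)"
    (is "?S \<le> _")
proof -
  define s where "s = sqrt (2 * real T)"
  have s: "s > 0" "s\<^sup>2 = 2 * real T"
    using \<open>T \<ge> 1\<close> by (auto simp: s_def)
  have eta': "\<eta> * (B * s) = R" "\<eta> > 0"
    using eta s \<open>B > 0\<close> \<open>R > 0\<close> by (auto simp: s_def[symmetric])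
  have "2 * \<eta> * ?S \<le> (norm (u - l 1))\<^sup>2 - (norm (u - l (T + 1)))\<^sup>2
      + \<eta>\<^sup>2 * (\<Sum>t=1..T. (norm (constraint_vec g (\<theta> t)))\<^sup>2)"
    using run u
    by (intro projected_ascent_regret[OF convex_multipliers compact_imp_closed[OF compact_multipliers]])
      (auto simp: oracle_lagrangian_run_def)
  \<comment> \<open>Since \<open>l 1 = 0\<close>, the initial distance is the norm of
    \<open>u\<close>; the final distance is dropped.\<close>
  also have "\<dots> \<le> R\<^sup>2 - 0 + \<eta>\<^sup>2 * (\<Sum>t=1..T. B\<^sup>2)"
  proof -
    have "l 1 = 0"
      using run by (simp add: oracle_lagrangian_run_def)
    then have "(norm (u - l 1))\<^sup>2 \<le> R\<^sup>2"
      using norm_multipliers_le[OF u] by (simp add: power_mono)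
    moreover have "(\<Sum>t=1..T. (norm (constraint_vec g (\<theta> t)))\<^sup>2) \<le> (\<Sum>t=1..T. B\<^sup>2)"
      using B by (intro sum_mono power_mono) auto
    ultimately show ?thesis
      by (intro add_mono diff_mono mult_left_mono) auto
  qed
  also have "\<dots> = R\<^sup>2 + (\<eta> * (B * s))\<^sup>2 / 2"
    using s by (simp add: power_mult_distrib)
  \<comment> \<open>The initial distance gives \<open>R\<^sup>2\<close> and the gradients
    \<open>R\<^sup>2 / 2\<close>. One factor \<open>R\<close> is kept as
    \<open>\<eta> * (B * s)\<close> so that \<open>2 * \<eta>\<close> can be cancelled.\<close>
  also have "\<dots> = 3/2 * R * (\<eta> * (B * s))"
    unfolding eta' by (simp add: power2_eq_square)
  finally have "2 * \<eta> * ?S \<le> 2 * \<eta> * (3/4 * R * B * s)"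
    by (simp add: algebra_simps)
  then show ?thesis
    using \<open>\<eta> > 0\<close> by (simp add: s_def mult_ac)
qed

theorem lemma1:
  fixes \<Theta> :: "'a set"
    and g0 :: "'a \<Rightarrow> real" and g :: "'m::finite \<Rightarrow> 'a \<Rightarrow> real"
    and R \<rho> \<eta> B :: real and T :: nat
    and Orc :: "('a \<Rightarrow> real) \<Rightarrow> 'a"
    and \<theta> :: "nat \<Rightarrow> 'a" and l :: "nat \<Rightarrow> real ^ 'm"
  assumes "\<Theta> \<noteq> {}"
    and "R > 0"
    and "T \<ge> 1"
    and "approx_bo_oracle \<Theta> g0 g \<rho> Orc"
    and "oracle_lagrangian_run R g0 g Orc T \<eta> \<theta> l"
    and "B > 0"
    and "B \<ge> (MAX t\<in>{1..T}. norm (constraint_vec g (\<theta> t)))"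
    and "\<eta> = R / (B * sqrt (2 * real T))"
  shows "(\<exists>l'. is_arg_max (\<lambda>l'. 1 / real T * (\<Sum>t=1..T. lagrangian g0 g (\<theta> t) l'))
                 (\<lambda>l'. l' \<in> multipliers R) l') \<and>
    (SUP l'\<in>multipliers R. ereal (1 / real T * (\<Sum>t=1..T. lagrangian g0 g (\<theta> t) l')))
      - (INF \<theta>'\<in>\<Theta>. ereal (1 / real T * (\<Sum>t=1..T. lagrangian g0 g \<theta>' (l t))))
    \<le> ereal (\<rho> + R * B * sqrt (2 / real T))"
proof (intro conjI)
  let ?avg = "1 / real T * (\<Sum>t=1..T. lagrangian g0 g (\<theta> t) (l t))"
  let ?F = "\<lambda>l'. 1 / real T * (\<Sum>t=1..T. lagrangian g0 g (\<theta> t) l')"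
  let ?G = "\<lambda>\<theta>'. 1 / real T * (\<Sum>t=1..T. lagrangian g0 g \<theta>' (l t))"
  have ne: "multipliers R \<noteq> ({} :: (real ^ 'm) set)"
    using zero_in_multipliers[of R] \<open>R > 0\<close> by auto
  \<comment> \<open>An attained maximum justifies reading the supremum in the second conjunct as a
    maximum.\<close>
  have "continuous_on (multipliers R) ?F"
    unfolding lagrangian_def by (intro continuous_intros)
  then obtain l' where "l' \<in> multipliers R" "\<forall>l''\<in>multipliers R. ?F l'' \<le> ?F l'"
    using continuous_attains_sup[OF compact_multipliers ne] by blast
  then show "\<exists>l'. is_arg_max ?F (\<lambda>l'. l' \<in> multipliers R) l'"
    by (auto simp: is_arg_max_linorder)
  have B: "norm (constraint_vec g (\<theta> t)) \<le> B" if "t \<in> {1..T}" for t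
    using that \<open>B \<ge> _\<close> by (subst (asm) Max_le_iff) auto
  have "?F u \<le> ?avg + R * B * sqrt (2 / real T)" if u: "u \<in> multipliers R" for u
  proof -
    \<comment> \<open>Both averages use the same \<open>\<theta> t\<close>, so the \<open>g0\<close>
      terms cancel.\<close>
    have "?F u - ?avg = 1 / real T * (\<Sum>t=1..T. (u - l t) \<bullet> constraint_vec g (\<theta> t))"
      by (simp add: lagrangian_eq_inner inner_diff_left sum.distrib sum_subtractf diff_divide_distrib
          add_divide_distrib)
    also have "\<dots> \<le> 1 / real T * (3/4 * R * B * sqrt (2 * real T))"
      using assms B u by (intro mult_left_mono oracle_lagrangian_regret) auto
    also have "\<dots> = 3/4 * (R * B * sqrt (2 / real T))"
      using \<open>T \<ge> 1\<close> by (simp add: real_sqrt_mult real_sqrt_divide field_simps)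
    also have "\<dots> \<le> R * B * sqrt (2 / real T)"
      using \<open>R > 0\<close> \<open>B > 0\<close> by simp
    finally show ?thesis by simp
  qed
  then have upper: "(SUP l'\<in>multipliers R. ereal (?F l')) \<le> ereal (?avg + R * B * sqrt (2 / real T))"
    by (intro SUP_least) simp
  \<comment> \<open>One fixed \<open>\<theta>'\<close> is compared with the oracle's answer in every
    round; averaging leaves a single \<open>\<rho>\<close>.\<close>
  have "?avg - \<rho> \<le> ?G \<theta>'" if "\<theta>' \<in> \<Theta>" for \<theta>'
  proof -
    have "lagrangian g0 g (\<theta> t) (l t) \<le> lagrangian g0 g \<theta>' (l t) + \<rho>" if "t \<in> {1..T}" for t
    proof -
      have "l t \<in> multipliers R"
        using assms(2) oracle_lagrangian_run_multipliers[OF _ assms(5) that] by simp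
      moreover have "\<theta> t = Orc (\<lambda>x. lagrangian g0 g x (l t))"
        using assms(5) that by (simp add: oracle_lagrangian_run_def)
      ultimately show ?thesis
        using approx_bo_oracle_lagrangian[OF assms(4) _ \<open>\<theta>' \<in> \<Theta>\<close>] by simp
    qed
    then have "?avg \<le> 1 / real T * (\<Sum>t=1..T. lagrangian g0 g \<theta>' (l t) + \<rho>)"
      by (intro mult_left_mono sum_mono) auto
    also have "\<dots> = ?G \<theta>' + \<rho>"
      using \<open>T \<ge> 1\<close> by (simp add: sum.distrib field_simps)
    finally show ?thesis by simp
  qed
  then have lower: "ereal (?avg - \<rho>) \<le> (INF \<theta>'\<in>\<Theta>. ereal (?G \<theta>'))"
    by (intro INF_greatest) simp
  \<comment> \<open>Both bounds are real numbers, so in their difference \<open>?avg\<close>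
    cancels.\<close>
  show "(SUP l'\<in>multipliers R. ereal (?F l')) - (INF \<theta>'\<in>\<Theta>. ereal (?G \<theta>'))
      \<le> ereal (\<rho> + R * B * sqrt (2 / real T))"
    using ereal_minus_mono[OF upper lower] by (simp add: algebra_simps)
qed

end
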